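(* Let $B$ be an integral base-polyhedron in $\mathbb{R}^S$ and $\dot B=B\cap\mathbb{Z}^S$ the set of its integral elements. An element $m$ of $\dot B$ is decreasingly minimal in $\dot B$ if and only if $m$ is least majorized in $\dot B$.
   Context: $S$ is a finite nonempty set. An integral base-polyhedron is a nonempty $B=\{x\in\mathbb{R}^S:\widetilde x(S)=p(S),\ \widetilde x(Z)\ge p(Z)\ \forall Z\subset S\}$ for an integer-valued supermodular $p:2^S\to\mathbb{Z}\cup\{-\infty\}$ with $p(\emptyset)=0$, $p(S)$ finite, where $\widetilde x(Z)=\sum_{v\in Z}x(v)$. For a vector $x$, $x{\downarrow}$ sorts components decreasingly and $\overline{x}(k)=\sum_{i=1}^k x{\downarrow}(i)$; $x\prec y$ means $\overline{x}(k)\le\overline{y}(k)$ for all $k$ and $\overline x(|S|)=\overline y(|S|)$; $m$ is least majorized in $\dot B$ if $m\prec y$ for all $y\in\dot B$. $m$ is decreasingly minimal in $\dot B$ if for every $y\in\dot B$ either $m{\downarrow}=y{\downarrow}$ or $m{\downarrow}(j)<y{\downarrow}(j)$ at the smallest index $j$ of difference. *)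

theory Defs
  imports "HOL-Analysis.Analysis" "HOL-Library.Multiset"
begin

(* The ground set S is the index type 's::finite (finite and nonempty), so that R^S is
   real ^ 's and S itself is UNIV. *)

definition tilde :: "real ^ 's::finite \<Rightarrow> 's set \<Rightarrow> real" where
  "tilde x Z = (\<Sum>v\<in>Z. x $ v)"

(* Values in the integers together with minus infinity. *)
definition int_or_minf_valued :: "('s set \<Rightarrow> ereal) \<Rightarrow> bool" where
  "int_or_minf_valued p \<longleftrightarrow> (\<forall>Z. p Z = -\<infinity> \<or> (\<exists>k::int. p Z = ereal (real_of_int k)))"

(* For p never equal to plus infinity, the sums below are the usual ones in the reals with
   minus infinity, so the inequality says something only when p X and p Y are both finite;
   p (X \<inter> Y) and p (X \<union> Y) are then forced to be finite as well. *)
definition supermodular :: "('s set \<Rightarrow> ereal) \<Rightarrow> bool" where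
  "supermodular p \<longleftrightarrow> (\<forall>X Y. p X + p Y \<le> p (X \<inter> Y) + p (X \<union> Y))"

definition base_polyhedron :: "('s::finite set \<Rightarrow> ereal) \<Rightarrow> (real ^ 's) set" where
  "base_polyhedron p = {x. ereal (tilde x UNIV) = p UNIV \<and> (\<forall>Z. ereal (tilde x Z) \<ge> p Z)}"

definition integral_base_polyhedron :: "(real ^ 's::finite) set \<Rightarrow> bool" where
  "integral_base_polyhedron B \<longleftrightarrow>
     (\<exists>p. int_or_minf_valued p \<and> supermodular p \<and> p {} = 0 \<and> p UNIV \<noteq> -\<infinity> \<and>
          B = base_polyhedron p \<and> B \<noteq> {})"

definition integral_elements :: "(real ^ 's::finite) set \<Rightarrow> (real ^ 's) set" where
  "integral_elements B = {x \<in> B. \<forall>v. x $ v \<in> \<int>}"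

(* List positions start at 0: the i-th largest component is sort_desc x ! (i - 1). *)
definition sort_desc :: "real ^ 's::finite \<Rightarrow> real list" where
  "sort_desc x = rev (sorted_list_of_multiset (image_mset (\<lambda>v. x $ v) (mset_set UNIV)))"

definition top_sum :: "real ^ 's::finite \<Rightarrow> nat \<Rightarrow> real" where
  "top_sum x k = (\<Sum>i=1..k. sort_desc x ! (i - 1))"

definition majorized_by :: "real ^ 's::finite \<Rightarrow> real ^ 's \<Rightarrow> bool"  (infix "\<prec>\<^sub>m" 50) where
  "x \<prec>\<^sub>m y \<longleftrightarrow> (\<forall>k\<in>{1..CARD('s)}. top_sum x k \<le> top_sum y k) \<and>
             top_sum x CARD('s) = top_sum y CARD('s)"

definition least_majorized_in :: "(real ^ 's::finite) set \<Rightarrow> real ^ 's \<Rightarrow> bool" where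
  "least_majorized_in D m \<longleftrightarrow> m \<in> D \<and> (\<forall>y\<in>D. m \<prec>\<^sub>m y)"

definition decreasingly_minimal_in :: "(real ^ 's::finite) set \<Rightarrow> real ^ 's \<Rightarrow> bool" where
  "decreasingly_minimal_in D m \<longleftrightarrow> m \<in> D \<and>
     (\<forall>y\<in>D. sort_desc m = sort_desc y \<or>
        (\<exists>j<CARD('s). (\<forall>i<j. sort_desc m ! i = sort_desc y ! i) \<and>
                      sort_desc m ! j < sort_desc y ! j))"

end

theory Submission
  imports Defs
begin

text \<open>
  Majorization is equivalent to comparing the sums of positive parts of \<open>x(v) - a\<close> over all
  thresholds \<open>a\<close>. If \<open>m\<close> is decreasingly minimal, then moving a unit from \<open>s\<close> to \<open>t\<close> must leave the
  polyhedron whenever \<open>m(s) \<ge> m(t) + 2\<close>, so some \<open>m\<close>-tight set contains \<open>s\<close> but not \<open>t\<close>. Tight sets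
  form a lattice, so for each integer \<open>a\<close> there is a tight set \<open>Z\<close> between \<open>{m > a}\<close> and \<open>{m \<ge> a}\<close>.
  Then \<open>\<Sum>(m - a)\<^sup>+ = p(Z) - a|Z| \<le> y(Z) - a|Z| \<le> \<Sum>(y - a)\<^sup>+\<close> for every \<open>y\<close> in the polyhedron.
\<close>

definition excess :: "real \<Rightarrow> real ^ 's::finite \<Rightarrow> real" where
  "excess a x = (\<Sum>v\<in>UNIV. max 0 (x $ v - a))"

definition transfer :: "'s \<Rightarrow> 's \<Rightarrow> real ^ 's::finite \<Rightarrow> real ^ 's" where
  "transfer s t x = x - axis s 1 + axis t 1"

definition tight :: "('s::finite set \<Rightarrow> ereal) \<Rightarrow> real ^ 's \<Rightarrow> 's set \<Rightarrow> bool" where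
  "tight p x Z \<longleftrightarrow> p Z = ereal (tilde x Z)"

section \<open>Sorted components, top sums and excess\<close>

lemma mset_sort_desc: "mset (sort_desc x) = image_mset (\<lambda>v. x $ v) (mset_set UNIV)"
  by (simp add: sort_desc_def)

lemma length_sort_desc [simp]: "length (sort_desc (x :: real ^ 's::finite)) = CARD('s)"
  by (metis mset_sort_desc size_image_mset size_mset size_mset_set)

lemma set_sort_desc: "set (sort_desc x) = range (\<lambda>v. x $ v)"
  unfolding set_mset_mset[symmetric] mset_sort_desc by simp

lemma sort_desc_nth_mono:
  fixes x :: "real ^ 's::finite"
  assumes "i \<le> j" "j < CARD('s)"
  shows "sort_desc x ! j \<le> sort_desc x ! i"
proof -
  have "sorted_wrt (\<ge>) (sort_desc x)"
    by (simp add: sort_desc_def sorted_wrt_rev)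
  then show ?thesis
    using assms by (cases "i = j") (auto simp: sorted_wrt_iff_nth_less)
qed

text \<open>Sorting only permutes the components. In particular, \<open>excess a x\<close> depends
  on \<open>sort_desc x\<close> alone.\<close>

lemma sum_sort_desc:
  fixes x :: "real ^ 's::finite" and f :: "real \<Rightarrow> real"
  shows "(\<Sum>i<CARD('s). f (sort_desc x ! i)) = (\<Sum>v\<in>UNIV. f (x $ v))"
proof -
  have "(\<Sum>i<CARD('s). f (sort_desc x ! i)) = sum_list (map f (sort_desc x))"
    by (simp add: sum_list_sum_nth atLeast0LessThan)
  also have "\<dots> = sum_mset (image_mset f (mset (sort_desc x)))"
    by (metis mset_map sum_mset_sum_list)
  also have "\<dots> = (\<Sum>v\<in>UNIV. f (x $ v))"
    by (simp add: mset_sort_desc image_mset.compositionality comp_def sum_unfold_sum_mset)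
  finally show ?thesis .
qed

lemma top_sum_lessThan: "top_sum x k = (\<Sum>i<k. sort_desc x ! i)"
  unfolding top_sum_def
  by (rule sum.reindex_bij_witness[of _ Suc "\<lambda>i. i - 1"]) auto

lemma top_sum_card: "top_sum (x :: real ^ 's::finite) CARD('s) = tilde x UNIV"
  using sum_sort_desc[of "\<lambda>u. u" x] by (simp add: top_sum_lessThan tilde_def)

text \<open>Each entry \<open>u\<close> is at most \<open>a + max 0 (u - a)\<close>, and extending
  the sum of positive parts to all indices only adds nonnegative terms. With
  \<open>top_sum_eq_excess\<close>, for k >= 1, the top sum is the minimum of
  \<open>k * a + excess a x\<close> over \<open>a\<close>.\<close>

lemma top_sum_le_excess:
  fixes x :: "real ^ 's::finite"
  assumes "k \<le> CARD('s)"
  shows "top_sum x k \<le> real k * a + excess a x"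
proof -
  have "top_sum x k \<le> (\<Sum>i<k. a + max 0 (sort_desc x ! i - a))"
    unfolding top_sum_lessThan by (rule sum_mono) simp
  also have "\<dots> = real k * a + (\<Sum>i<k. max 0 (sort_desc x ! i - a))"
    by (simp add: sum.distrib)
  also have "(\<Sum>i<k. max 0 (sort_desc x ! i - a)) \<le> (\<Sum>i<CARD('s). max 0 (sort_desc x ! i - a))"
    using assms by (intro sum_mono2) auto
  also have "\<dots> = excess a x"
    unfolding excess_def by (rule sum_sort_desc)
  finally show ?thesis by simp
qed

text \<open>At this threshold the entries up to index \<open>k\<close> are at least \<open>a\<close>
  and the later ones at most \<open>a\<close>, so both estimates behind
  \<open>top_sum_le_excess\<close> become equalities.\<close>

lemma top_sum_eq_excess:
  fixes x :: "real ^ 's::finite"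
  assumes "k < CARD('s)"
  defines "a \<equiv> sort_desc x ! k"
  shows "top_sum x (Suc k) = real (Suc k) * a + excess a x"
proof -
  have "excess a x = (\<Sum>i<CARD('s). max 0 (sort_desc x ! i - a))"
    unfolding excess_def by (rule sum_sort_desc[symmetric])
  also have "\<dots> = (\<Sum>i<Suc k. max 0 (sort_desc x ! i - a))"
    using assms by (intro sum.mono_neutral_right) (auto simp: not_less max_def sort_desc_nth_mono antisym)
  also have "\<dots> = (\<Sum>i<Suc k. sort_desc x ! i - a)"
    using assms sort_desc_nth_mono[of _ k x] by (intro sum.cong) (auto simp: max_def less_Suc_eq_le)
  also have "\<dots> = top_sum x (Suc k) - real (Suc k) * a"
    by (simp only: sum_subtractf top_sum_lessThan sum_constant card_lessThan)
  finally show ?thesis by simp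
qed

text \<open>The upper bound on the top sums of \<open>x\<close> holds at every threshold, so it
  suffices to use the one where the bound for \<open>y\<close> is attained, an entry of
  \<open>y\<close>. For integral \<open>y\<close> these thresholds are integers.\<close>

lemma majorized_byI:
  fixes x y :: "real ^ 's::finite"
  assumes "\<And>v. excess (y $ v) x \<le> excess (y $ v) y" and "tilde x UNIV = tilde y UNIV"
  shows "x \<prec>\<^sub>m y"
  unfolding majorized_by_def
proof (intro conjI ballI)
  fix k assume "k \<in> {1..CARD('s)}"
  then obtain j where j: "k = Suc j" "j < CARD('s)" by (cases k) auto
  let ?a = "sort_desc y ! j"
  have "?a \<in> range (\<lambda>v. y $ v)"
    using j by (metis length_sort_desc nth_mem set_sort_desc)
  then have "excess ?a x \<le> excess ?a y" using assms(1) by auto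
  moreover have "top_sum x k \<le> real k * ?a + excess ?a x"
    using j by (intro top_sum_le_excess) simp
  ultimately show "top_sum x k \<le> top_sum y k"
    using top_sum_eq_excess[OF j(2), of y] by (simp add: j(1))
qed (simp add: top_sum_card assms(2))

section \<open>Majorization and lexicographic comparison\<close>

lemma majorized_by_imp_not_lex_greater:
  fixes x y :: "real ^ 's::finite"
  assumes "x \<prec>\<^sub>m y" "j < CARD('s)" "\<And>i. i < j \<Longrightarrow> sort_desc x ! i = sort_desc y ! i"
  shows "sort_desc x ! j \<le> sort_desc y ! j"
proof -
  \<comment> \<open>The equal entries before \<open>j\<close> cancel from the top sums of length
    \<open>Suc j\<close>.\<close>
  have "top_sum x (Suc j) \<le> top_sum y (Suc j)"
    using assms(1,2) by (auto simp: majorized_by_def)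
  moreover have "top_sum x j = top_sum y j"
    unfolding top_sum_lessThan using assms(3) by (intro sum.cong) auto
  ultimately show ?thesis by (simp add: top_sum_lessThan)
qed

lemma least_majorized_imp_decreasingly_minimal:
  fixes m :: "real ^ 's::finite"
  assumes "least_majorized_in D m"
  shows "decreasingly_minimal_in D m"
  unfolding decreasingly_minimal_in_def
proof (intro conjI ballI)
  show "m \<in> D" using assms by (simp add: least_majorized_in_def)
  fix y assume "y \<in> D"
  then have maj: "m \<prec>\<^sub>m y" using assms by (simp add: least_majorized_in_def)
  let ?P = "\<lambda>j. j < CARD('s) \<and> sort_desc m ! j \<noteq> sort_desc y ! j"
  show "sort_desc m = sort_desc y \<or>
        (\<exists>j<CARD('s). (\<forall>i<j. sort_desc m ! i = sort_desc y ! i) \<and> sort_desc m ! j < sort_desc y ! j)"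
  proof (cases "sort_desc m = sort_desc y")
    case True
    then show ?thesis ..
  next
    case False
    then have "\<exists>j. ?P j" by (metis length_sort_desc nth_equalityI)
    then obtain j where j: "?P j" and first: "\<And>i. i < j \<Longrightarrow> \<not> ?P i"
      using exists_least_iff[of ?P] by blast
    have eq: "sort_desc m ! i = sort_desc y ! i" if "i < j" for i
      using first[OF that] j that by auto
    have "sort_desc m ! j < sort_desc y ! j"
      using majorized_by_imp_not_lex_greater[OF maj, of j] eq j by force
    then show ?thesis using eq j by blast
  qed
qed

text \<open>Minimality of \<open>m\<close> rules out a lexicographically smaller \<open>y\<close>,
  and majorization by \<open>m\<close> rules out a larger one.\<close>

lemma decreasingly_minimal_majorized_by:
  assumes "decreasingly_minimal_in D m" "y \<in> D" "y \<prec>\<^sub>m m"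
  shows "sort_desc y = sort_desc m"
proof (rule ccontr)
  assume "sort_desc y \<noteq> sort_desc m"
  then obtain j where "j < CARD('a)" "\<And>i. i < j \<Longrightarrow> sort_desc y ! i = sort_desc m ! i"
    "sort_desc m ! j < sort_desc y ! j"
    using assms(1,2) unfolding decreasingly_minimal_in_def by metis
  then show False
    using majorized_by_imp_not_lex_greater[OF assms(3), of j] by force
qed

section \<open>Unit transfers between two components\<close>

lemma tilde_transfer:
  "tilde (transfer s t x) Z = tilde x Z - of_bool (s \<in> Z) + of_bool (t \<in> Z)"
proof -
  have "(\<Sum>v\<in>Z. axis u (1::real) $ v) = of_bool (u \<in> Z)" for u
    by (simp add: axis_def of_bool_def)
  then show ?thesis
    by (simp add: tilde_def transfer_def sum.distrib sum_subtractf)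
qed

lemma excess_transfer:
  assumes "s \<noteq> t"
  shows "excess a (transfer s t x) - excess a x =
    (max 0 (x $ s - 1 - a) - max 0 (x $ s - a)) + (max 0 (x $ t + 1 - a) - max 0 (x $ t - a))"
proof -
  have split: "sum f UNIV = f s + (f t + sum f (UNIV - {s} - {t}))" for f :: "_ \<Rightarrow> real"
    using assms by (simp add: sum.remove[of _ s] sum.remove[of _ t])
  have "(\<Sum>v\<in>UNIV - {s} - {t}. max 0 (transfer s t x $ v - a)) =
    (\<Sum>v\<in>UNIV - {s} - {t}. max 0 (x $ v - a))"
    by (intro sum.cong) (auto simp: transfer_def axis_def)
  moreover have "transfer s t x $ s = x $ s - 1" "transfer s t x $ t = x $ t + 1"
    using assms by (auto simp: transfer_def axis_def)
  ultimately show ?thesis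
    unfolding excess_def by (simp add: split)
qed

text \<open>By convexity of \<open>max 0 (u - a)\<close> in \<open>u\<close>, moving a unit across a
  gap of at least 2 never raises an excess, and it lowers one strictly.\<close>

lemma decreasingly_minimal_transfer_notin:
  assumes "decreasingly_minimal_in D m" "m $ t + 2 \<le> m $ s"
  shows "transfer s t m \<notin> D"
proof
  assume "transfer s t m \<in> D"
  have "s \<noteq> t" using assms(2) by auto
  have "transfer s t m \<prec>\<^sub>m m"
  proof (rule majorized_byI)
    show "excess (m $ v) (transfer s t m) \<le> excess (m $ v) m" for v
      using excess_transfer[OF \<open>s \<noteq> t\<close>, of "m $ v" m] assms(2) by (auto simp: max_def split: if_splits)
  qed (simp add: tilde_transfer)
  then have "sort_desc (transfer s t m) = sort_desc m"
    using decreasingly_minimal_majorized_by assms(1) \<open>transfer s t m \<in> D\<close> by blast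
  \<comment> \<open>At threshold \<open>m $ s - 1\<close> the term of \<open>s\<close> drops from 1
    to 0, while that of \<open>t\<close> stays 0 because \<open>m $ t + 1\<close> does not exceed
    the threshold.\<close>
  then have "excess (m $ s - 1) (transfer s t m) = excess (m $ s - 1) m"
    unfolding excess_def
    using sum_sort_desc[of "\<lambda>u. max 0 (u - (m $ s - 1))" m]
      sum_sort_desc[of "\<lambda>u. max 0 (u - (m $ s - 1))" "transfer s t m"] by simp
  then show False
    using excess_transfer[OF \<open>s \<noteq> t\<close>, of "m $ s - 1" m] assms(2) by (auto simp: max_def split: if_splits)
qed

section \<open>Tight sets\<close>

lemma tight_Int_Un:
  assumes "supermodular p" "x \<in> base_polyhedron p" "tight p x X" "tight p x Y"
  shows "tight p x (X \<inter> Y)" "tight p x (X \<union> Y)"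
proof -
  \<comment> \<open>By modularity of \<open>tilde x\<close>, the bounds of \<open>p\<close> on
    intersection and union have the same total as the finite values \<open>p X + p Y\<close>.
    Supermodularity then forces equality in both.\<close>
  have "tilde x X + tilde x Y = tilde x (X \<inter> Y) + tilde x (X \<union> Y)"
    unfolding tilde_def using sum.union_inter[of X Y "($) x"] by simp
  moreover have "p X + p Y \<le> p (X \<inter> Y) + p (X \<union> Y)"
    using assms(1) by (simp add: supermodular_def)
  moreover have "p (X \<inter> Y) \<le> ereal (tilde x (X \<inter> Y))" "p (X \<union> Y) \<le> ereal (tilde x (X \<union> Y))"
    using assms(2) by (auto simp: base_polyhedron_def)
  ultimately show "tight p x (X \<inter> Y)" "tight p x (X \<union> Y)"
    using assms(3,4) unfolding tight_def
    by (cases "p (X \<inter> Y)"; cases "p (X \<union> Y)"; simp)+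
qed

text \<open>For fixed \<open>s\<close>, intersect the separating sets over \<open>t\<close> in
  \<open>L\<close>; then unite the results over \<open>s\<close> in \<open>U\<close>. The empty
  intersection \<open>UNIV\<close> and the empty union \<open>{}\<close> are tight as well.\<close>

lemma tight_separating:
  fixes x :: "real ^ 's::finite"
  assumes "supermodular p" "p {} = 0" "x \<in> base_polyhedron p"
    and sep: "\<And>s t. s \<in> U \<Longrightarrow> t \<in> L \<Longrightarrow> \<exists>Z. tight p x Z \<and> s \<in> Z \<and> t \<notin> Z"
  shows "\<exists>Z. tight p x Z \<and> U \<subseteq> Z \<and> Z \<inter> L = {}"
proof -
  have single: "\<exists>Z. tight p x Z \<and> s \<in> Z \<and> Z \<inter> L = {}" if "s \<in> U" for s
    using finite[of L] sep[OF that]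
  proof (induction L rule: finite_induct)
    case empty
    have "tight p x UNIV" using assms(3) by (simp add: tight_def base_polyhedron_def)
    then show ?case by blast
  next
    case (insert t L)
    have "\<exists>Z. tight p x Z \<and> s \<in> Z \<and> Z \<inter> L = {}"
      by (rule insert.IH) (rule insert.prems, simp)
    then obtain Z where "tight p x Z" "s \<in> Z" "Z \<inter> L = {}" by blast
    moreover obtain Z' where "tight p x Z'" "s \<in> Z'" "t \<notin> Z'" using insert.prems by blast
    ultimately show ?case
      using tight_Int_Un(1)[OF assms(1,3)] by (intro exI[of _ "Z \<inter> Z'"]) auto
  qed
  show ?thesis
    using finite[of U] single
  proof (induction U rule: finite_induct)
    case empty
    have "tight p x {}" using assms(2) by (simp add: tight_def tilde_def)
    then show ?case by blast
  next
    case (insert s U)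
    have "\<exists>Z. tight p x Z \<and> U \<subseteq> Z \<and> Z \<inter> L = {}"
      by (rule insert.IH) (rule insert.prems, simp)
    then obtain Z where "tight p x Z" "U \<subseteq> Z" "Z \<inter> L = {}" by blast
    moreover obtain Z' where "tight p x Z'" "s \<in> Z'" "Z' \<inter> L = {}" using insert.prems by blast
    ultimately show ?case
      using tight_Int_Un(2)[OF assms(1,3)] by (intro exI[of _ "Z \<union> Z'"]) auto
  qed
qed

text \<open>A transfer lowers \<open>tilde x Z\<close> only if \<open>Z\<close> contains
  \<open>s\<close> but not \<open>t\<close>, and then by exactly 1. Without a tight set of this
  kind, integrality leaves enough slack for all constraints to survive.\<close>

lemma transfer_notin_imp_tight:
  assumes "int_or_minf_valued p" "x \<in> integral_elements (base_polyhedron p)"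
    and "transfer s t x \<notin> integral_elements (base_polyhedron p)"
  shows "\<exists>Z. tight p x Z \<and> s \<in> Z \<and> t \<notin> Z"
proof (rule ccontr)
  assume no: "\<not> ?thesis"
  have x: "x \<in> base_polyhedron p" "\<And>v. x $ v \<in> \<int>"
    using assms(2) by (auto simp: integral_elements_def)
  have "p Z \<le> ereal (tilde (transfer s t x) Z)" for Z
  proof (cases "s \<in> Z \<and> t \<notin> Z")
    case True
    then have "p Z \<noteq> ereal (tilde x Z)" using no by (auto simp: tight_def)
    moreover have "p Z \<le> ereal (tilde x Z)" using x(1) by (simp add: base_polyhedron_def)
    \<comment> \<open>If \<open>p Z\<close> is finite, both sides are integers, so the strict
      inequality leaves a slack of at least 1.\<close>
    moreover have "tilde x Z \<in> \<int>" using x(2) by (auto simp: tilde_def)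
    then obtain n where "tilde x Z = of_int n" by (auto elim: Ints_cases)
    ultimately show ?thesis
      using assms(1)[unfolded int_or_minf_valued_def, rule_format, of Z] True
      by (auto simp: tilde_transfer)
  next
    case False
    then have "tilde x Z \<le> tilde (transfer s t x) Z" by (auto simp: tilde_transfer)
    moreover have "p Z \<le> ereal (tilde x Z)" using x(1) by (simp add: base_polyhedron_def)
    ultimately show ?thesis by (meson ereal_less_eq(3) order_trans)
  qed
  moreover have "ereal (tilde (transfer s t x) UNIV) = p UNIV"
    using x(1) by (simp add: tilde_transfer base_polyhedron_def)
  moreover have "transfer s t x $ v \<in> \<int>" for v
    using x(2) by (auto simp: transfer_def axis_def)
  ultimately show False
    using assms(3) by (simp add: integral_elements_def base_polyhedron_def)
qed

section \<open>From tight sets to majorization\<close>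

lemma excess_le_of_tight:
  assumes "x \<in> base_polyhedron p" "y \<in> base_polyhedron p" "tight p x Z"
    and "{v. a < x $ v} \<subseteq> Z" "Z \<subseteq> {v. a \<le> x $ v}"
  shows "excess a x \<le> excess a y"
proof -
  have "x $ v \<le> a" if "v \<notin> Z" for v
    using assms(4) that by (auto simp: not_less[symmetric])
  \<comment> \<open>Entries equal to \<open>a\<close> contribute zero, so it does not matter which
    of them lie in \<open>Z\<close>.\<close>
  then have "excess a x = (\<Sum>v\<in>Z. max 0 (x $ v - a))"
    unfolding excess_def by (intro sum.mono_neutral_right) (auto simp: max_absorb1)
  also have "\<dots> = (\<Sum>v\<in>Z. x $ v - a)"
    using assms(5) by (intro sum.cong) (auto simp: max_def)
  also have "\<dots> \<le> (\<Sum>v\<in>Z. y $ v - a)"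
  proof -
    have "p Z \<le> ereal (tilde y Z)"
      using assms(2) by (simp add: base_polyhedron_def)
    then show ?thesis using assms(3) by (simp add: tight_def tilde_def sum_subtractf)
  qed
  also have "\<dots> \<le> (\<Sum>v\<in>Z. max 0 (y $ v - a))"
    by (intro sum_mono) simp
  also have "\<dots> \<le> excess a y"
    unfolding excess_def by (intro sum_mono2) auto
  finally show ?thesis .
qed

lemma decreasingly_minimal_imp_least_majorized:
  assumes p: "int_or_minf_valued p" "supermodular p" "p {} = 0"
    and min: "decreasingly_minimal_in (integral_elements (base_polyhedron p)) m"
  shows "least_majorized_in (integral_elements (base_polyhedron p)) m"
proof -
  let ?D = "integral_elements (base_polyhedron p)"
  have mD: "m \<in> ?D" using min by (simp add: decreasingly_minimal_in_def)
  then have mB: "m \<in> base_polyhedron p" and mZ: "\<And>v. m $ v \<in> \<int>"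
    by (auto simp: integral_elements_def)
  have "m \<prec>\<^sub>m y" if "y \<in> ?D" for y
  proof (rule majorized_byI)
    have yB: "y \<in> base_polyhedron p" and yZ: "\<And>v. y $ v \<in> \<int>"
      using that by (auto simp: integral_elements_def)
    show "tilde m UNIV = tilde y UNIV"
      using mB yB by (metis (mono_tags, lifting) base_polyhedron_def ereal.inject mem_Collect_eq)
    fix v
    let ?a = "y $ v"
    have "\<exists>Z. tight p m Z \<and> {u. ?a < m $ u} \<subseteq> Z \<and> Z \<inter> {u. m $ u < ?a} = {}"
    proof (rule tight_separating[OF p(2,3) mB])
      fix s t assume "s \<in> {u. ?a < m $ u}" "t \<in> {u. m $ u < ?a}"
      \<comment> \<open>The threshold is an entry of the integral vector \<open>y\<close>, so an
        integer lies strictly between the integers \<open>m $ t\<close> and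
        \<open>m $ s\<close>.\<close>
      then have "m $ t + 2 \<le> m $ s"
        using mZ[of s] mZ[of t] yZ[of v] by (auto elim!: Ints_cases)
      then have "transfer s t m \<notin> ?D"
        by (rule decreasingly_minimal_transfer_notin[OF min])
      then show "\<exists>Z. tight p m Z \<and> s \<in> Z \<and> t \<notin> Z"
        by (rule transfer_notin_imp_tight[OF p(1) mD])
    qed
    then obtain Z where "tight p m Z" "{u. ?a < m $ u} \<subseteq> Z" "Z \<inter> {u. m $ u < ?a} = {}"
      by blast
    then show "excess ?a m \<le> excess ?a y"
      by (intro excess_le_of_tight[OF mB yB]) (auto simp: not_less[symmetric])
  qed
  then show ?thesis using mD by (simp add: least_majorized_in_def)
qed

theorem theorem2p10:
  fixes B :: "(real ^ 's::finite) set" and m :: "real ^ 's"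
  assumes "integral_base_polyhedron B"
    and "m \<in> integral_elements B"
  shows "decreasingly_minimal_in (integral_elements B) m \<longleftrightarrow>
         least_majorized_in (integral_elements B) m"
  using assms(1) decreasingly_minimal_imp_least_majorized least_majorized_imp_decreasingly_minimal
  unfolding integral_base_polyhedron_def by blast

end
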